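(* Assume that $0<\alpha<2$. If $\epsilon_nm^nb(m^n)^{-1}\to x\in(-\infty,+\infty)$ as $n\to\infty$, then $$\lim_{n\to\infty}P\left(S_{Z_n}/Z_n\ge\epsilon_n\right)=\int_0^\infty P\left(U_s\ge u^{\frac{\alpha-1}{\alpha}}x\right)\omega(u)\,du .$$
   Context: Galton-Watson process: $(Z_n)_{n\ge0}$ is a Galton-Watson process with $Z_0=1$ and offspring distribution $\{p_k\}_{k\ge0}$ such that $p_0=0$, $0<p_1<1$, with finite mean $m=\sum_{k\ge1}kp_k>1$ and $E[Z_1\log Z_1]<\infty$. Then $W=\lim_{n\to\infty}Z_n/m^n$ exists almost surely and has a continuous density $\omega$ on $(0,\infty)$. Sums: $(X_i)_{i\ge1}$ are i.i.d. real random variables, independent of $(Z_n)$, with distribution function $F(x)=P(X_1\le x)$; $S_n=X_1+\cdots+X_n$; $(\epsilon_n)$ is a sequence of real numbers. Standing Assumption A: (A1) $P(X_1\ge x)\sim x^{-\beta}L(x)$ as $x\to+\infty$, where $\beta>0$ and $L$ is a (positive) slowly varying function. (A2) If $\epsilon_n\to0$, then $L$ is bounded away from $0$ and $\infty$ on every compact subset of $[0,\infty)$. (A3) $X_1$ is in the domain of attraction of an $\alpha$-stable law, $0<\alpha<2$: $b(k)^{-1}S_k\to U_s$ in distribution, where $U_s$ is an $\alpha$-stable random variable and $b:[0,\infty)\to[0,\infty)$ is a fixed continuous, increasing, onto function with $b(0)=0$ and $b(x)=x^{1/\alpha}s(x)$ for $x>0$ with $s:(0,\infty)\to(0,\infty)$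 slowly varying. (A4) $E[X_1]=0$ if $1<\alpha<2$. Under these assumptions, $p_+=\lim_{x\to+\infty}\frac{1-F(x)}{1-F(x)+F(-x)}$ exists; it follows that $\alpha\le\beta$. Standing Assumption B: (B1) $U_s$ is strictly stable. (B2) If $1<\alpha<2$, then $\liminf_{x\to+\infty}s(x)\in(0,+\infty]$. (B3) If $0<p_+<1$ and $\alpha=1$, then $\int_{-x}^x yF(dy)=0$ for all $x>0$. (B4) If $p_+=0$, then $\alpha<\beta$. (B5) If $1<\alpha<2$ and $p_+>0$, then $\limsup_{n\to+\infty}\frac{F(-b(n)/[\log n]^{1/\alpha})}{(\log n)F(-b(n))}\le1$. *)

theory Defs
  imports "HOL-Probability.Probability" "HOL-Library.Landau_Symbols"
begin

text \<open>The variable \<open>\<xi> n i\<close> is the number of children of the \<open>i\<close>-th individual of generation \<open>n\<close>.\<close>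

definition galton_watson :: "'a measure \<Rightarrow> nat pmf \<Rightarrow> (nat \<Rightarrow> 'a \<Rightarrow> nat) \<Rightarrow> bool" where
  "galton_watson M p Z \<longleftrightarrow>
     (\<exists>\<xi> :: nat \<Rightarrow> nat \<Rightarrow> 'a \<Rightarrow> nat.
        prob_space.indep_vars M (\<lambda>_. count_space UNIV) (\<lambda>(n, i). \<xi> n i) UNIV \<and>
        (\<forall>n i. distr M (count_space UNIV) (\<xi> n i) = measure_pmf p) \<and>
        (\<forall>w\<in>space M. Z 0 w = 1) \<and>
        (\<forall>n. \<forall>w\<in>space M. Z (Suc n) w = (\<Sum>i<Z n w. \<xi> n i w)))"

text \<open>Values outside \<open>(0,\<infinity>)\<close> are irrelevant. Measurability is not demanded, as in Feller's
  definition.\<close>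

definition slowly_varying :: "(real \<Rightarrow> real) \<Rightarrow> bool" where
  "slowly_varying f \<longleftrightarrow>
     (\<forall>x>0. f x > 0) \<and> (\<forall>c>0. ((\<lambda>x. f (c * x) / f x) \<longlongrightarrow> 1) at_top)"

text \<open>A law \<open>\<mu>\<close> on the real line is \<open>\<alpha>\<close>-stable if it is not a point mass and, for independent
  \<open>Y\<^sub>0, Y\<^sub>1, \<dots>\<close> with law \<open>\<mu>\<close> and all \<open>n \<ge> 1\<close>, the sum \<open>Y\<^sub>0 + \<dots> + Y\<^sub>n\<^sub>-\<^sub>1\<close> has the same law as
  \<open>n powr (1/\<alpha>) * Y\<^sub>0 + \<gamma>\<close> for some constant \<open>\<gamma>\<close> depending on \<open>n\<close>. It is strictly stable if
  \<open>\<gamma> = 0\<close> for all \<open>n\<close>.\<close>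

definition alpha_stable :: "real \<Rightarrow> real measure \<Rightarrow> bool" where
  "alpha_stable \<alpha> \<mu> \<longleftrightarrow>
     real_distribution \<mu> \<and> (\<forall>c. \<mu> \<noteq> return borel c) \<and>
     (\<forall>n\<ge>1. \<exists>\<gamma>. distr (Pi\<^sub>M {..<n} (\<lambda>_. \<mu>)) borel (\<lambda>y. \<Sum>i<n. y i) =
        distr \<mu> borel (\<lambda>y. real n powr (1 / \<alpha>) * y + \<gamma>))"

definition strictly_alpha_stable :: "real \<Rightarrow> real measure \<Rightarrow> bool" where
  "strictly_alpha_stable \<alpha> \<mu> \<longleftrightarrow>
     real_distribution \<mu> \<and> (\<forall>c. \<mu> \<noteq> return borel c) \<and>
     (\<forall>n\<ge>1. distr (Pi\<^sub>M {..<n} (\<lambda>_. \<mu>)) borel (\<lambda>y. \<Sum>i<n. y i) =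
        distr \<mu> borel (\<lambda>y. real n powr (1 / \<alpha>) * y))"

definition p_plus :: "(real \<Rightarrow> real) \<Rightarrow> real" where
  "p_plus F = Lim at_top (\<lambda>x. (1 - F x) / (1 - F x + F (- x)))"

end

theory Submission
  imports Defs
begin

text \<open>Conditionally on the Galton-Watson process, the event says that \<open>S k / b k \<ge> k * \<epsilon> n / b k\<close> with
  \<open>k = Z n\<close>. Since \<open>Z n / m ^ n\<close> tends to \<open>W > 0\<close> and \<open>b\<close> is monotone and regularly varying with
  index \<open>1 / \<alpha>\<close>, the threshold converges to \<open>W powr ((\<alpha> - 1) / \<alpha>) * x\<close>. A strictly stable law has no
  atoms, so the conditional probability converges to the tail of \<open>U\<close> at this limit, and dominated
  convergence finishes the proof.\<close>

section \<open>Regular variation along asymptotically proportional sequences\<close>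

text \<open>Regular variation controls \<open>b (c * v) / b v\<close> only for a fixed factor
  \<open>c\<close>, whereas \<open>z n / y n\<close> varies with \<open>n\<close>. Monotonicity
  closes the gap: \<open>z n\<close> eventually lies on one side of \<open>c * y n\<close> for any
  fixed \<open>c\<close> below or above \<open>w\<close>, and \<open>c\<close> may be taken as close
  to \<open>w\<close> as desired. This replaces the uniform convergence theorem, which would require
  measurability.\<close>

lemma mono_regularly_varying_tendsto:
  fixes b :: "real \<Rightarrow> real" and y z :: "nat \<Rightarrow> real"
  assumes mono: "mono_on {0..} b"
    and pos: "\<And>v. v > 0 \<Longrightarrow> b v > 0"
    and rv: "\<And>c. c > 0 \<Longrightarrow> ((\<lambda>v. b (c * v) / b v) \<longlongrightarrow> c powr \<rho>) at_top"
    and y: "filterlim y at_top sequentially"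
    and quot: "(\<lambda>n. z n / y n) \<longlonglongrightarrow> w" and w: "w > 0"
  shows "(\<lambda>n. b (z n) / b (y n)) \<longlonglongrightarrow> w powr \<rho>"
proof -
  have cont: "((\<lambda>c. c powr \<rho>) \<longlongrightarrow> w powr \<rho>) (at w)"
    using w by (intro tendsto_intros) auto
  have ypos: "\<forall>\<^sub>F n in sequentially. y n > 0"
    using y by (simp add: filterlim_at_top_dense)
  have rv': "(\<lambda>n. b (c * y n) / b (y n)) \<longlonglongrightarrow> c powr \<rho>" if "c > 0" for c
    using filterlim_compose[OF rv[OF that] y] by simp
  show ?thesis
  proof (rule order_tendstoI)
    fix l assume l: "l < w powr \<rho>"
    have "\<forall>\<^sub>F c in at_left w. l < c powr \<rho>"
      using order_tendstoD(1)[OF cont l] by (simp add: eventually_at_split)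
    moreover have "\<forall>\<^sub>F c in at_left w. c \<in> {0<..<w}"
      using w by (rule eventually_at_left_real)
    ultimately have "\<forall>\<^sub>F c in at_left w. l < c powr \<rho> \<and> c \<in> {0<..<w}"
      by (rule eventually_conj)
    then obtain c where c: "l < c powr \<rho>" "0 < c" "c < w"
      using eventually_happens'[OF trivial_limit_at_left_real] by fastforce
    show "\<forall>\<^sub>F n in sequentially. l < b (z n) / b (y n)"
      using ypos order_tendstoD(1)[OF quot c(3)] order_tendstoD(1)[OF rv'[OF c(2)] c(1)]
    proof eventually_elim
      case (elim n)
      have "c * y n \<le> z n" using elim by (simp add: field_simps)
      moreover have "0 \<le> c * y n" using elim c by simp
      ultimately have "b (c * y n) \<le> b (z n)"
        by (intro mono_onD[OF mono]) auto
      then have "b (c * y n) / b (y n) \<le> b (z n) / b (y n)"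
        using pos[of "y n"] elim by (intro divide_right_mono) auto
      then show ?case using elim by linarith
    qed
  next
    fix l assume l: "w powr \<rho> < l"
    have "\<forall>\<^sub>F c in at_right w. c powr \<rho> < l"
      using order_tendstoD(2)[OF cont l] by (simp add: eventually_at_split)
    moreover have "\<forall>\<^sub>F c in at_right w. c \<in> {w<..<w+1}"
      by (rule eventually_at_right_real) simp
    ultimately have "\<forall>\<^sub>F c in at_right w. c powr \<rho> < l \<and> c \<in> {w<..<w+1}"
      by (rule eventually_conj)
    then obtain c where c: "c powr \<rho> < l" "w < c"
      using eventually_happens'[OF trivial_limit_at_right_real] by fastforce
    then have c0: "c > 0" using w by simp
    show "\<forall>\<^sub>F n in sequentially. b (z n) / b (y n) < l"
      \<comment> \<open>The bound \<open>z n / y n > 0\<close> puts \<open>z n\<close> into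
        \<open>{0..}\<close>, the only region where \<open>b\<close> is monotone. In the lower
        estimate the smaller argument is \<open>c * y n\<close>, which is clearly
        nonnegative.\<close>
      using ypos order_tendstoD(2)[OF quot c(2)] order_tendstoD(1)[OF quot w]
        order_tendstoD(2)[OF rv'[OF c0] c(1)]
    proof eventually_elim
      case (elim n)
      have "z n \<le> c * y n" using elim by (simp add: field_simps)
      moreover have "0 \<le> z n" using elim by (simp add: zero_less_divide_iff)
      ultimately have "b (z n) \<le> b (c * y n)"
        by (intro mono_onD[OF mono]) auto
      then have "b (z n) / b (y n) \<le> b (c * y n) / b (y n)"
        using pos[of "y n"] elim by (intro divide_right_mono) auto
      then show ?case using elim by linarith
    qed
  qed
qed

section \<open>Absence of atoms in strictly stable laws\<close>

lemma (in finite_measure) finite_heavy_atoms: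
  assumes "r > 0"
  shows "finite {z. r \<le> measure M {z}}"
proof -
  have "card F \<le> nat \<lceil>measure M (space M) / r\<rceil>" if F: "finite F" "F \<subseteq> {z. r \<le> measure M {z}}" for F
  proof -
    \<comment> \<open>\<open>measure\<close> takes the default value 0 off the sigma-algebra, so a
      singleton of mass at least \<open>r > 0\<close> is automatically measurable.\<close>
    have m: "{z} \<in> sets M" if "z \<in> F" for z
      using F that assms measure_notin_sets[of "{z}" M] by fastforce
    have "real (card F) * r \<le> (\<Sum>z\<in>F. measure M {z})"
      using F by (intro sum_bounded_below[of F r, simplified]) auto
    also have "\<dots> = measure M F"
      using F(1) m by (intro measure_eq_sum_singleton[symmetric]) auto
    also have "\<dots> \<le> measure M (space M)" by (rule bounded_measure)
    finally have "real (card F) \<le> measure M (space M) / r"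
      using assms by (simp add: field_simps)
    then show ?thesis by linarith
  qed
  then show ?thesis
    using finite_if_finite_subsets_card_bdd[of "{z. r \<le> measure M {z}}"] by blast
qed

text \<open>This is the convolution formula at a single point, obtained from Fubini on the two-fold
  product.\<close>

lemma (in real_distribution) emeasure_sum_two_singleton:
  "emeasure (distr (Pi\<^sub>M {..<2::nat} (\<lambda>_. M)) borel (\<lambda>y. \<Sum>i<2. y i)) {s}
    = (\<integral>\<^sup>+y. emeasure M {s - y} \<partial>M)"
proof -
  interpret P: product_sigma_finite "\<lambda>_::nat. M" by standard
  \<comment> \<open>In this form coordinate 1 can be split off as the outer integral, leaving a
    product over one index.\<close>
  have I2: "{..<2::nat} = insert 1 {0}" by auto
  have [measurable_cong]: "sets M = sets borel" by simp
  have [measurable]: "(\<lambda>y. \<Sum>i<2. y i) \<in> Pi\<^sub>M {..<2::nat} (\<lambda>_. M) \<rightarrow>\<^sub>M borel"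
    by (intro borel_measurable_sum) auto
  have [measurable]: "(\<lambda>y. \<Sum>i<2. y i) \<in> Pi\<^sub>M (insert 1 {0::nat}) (\<lambda>_. M) \<rightarrow>\<^sub>M borel"
    unfolding I2[symmetric] by measurable
  have "emeasure (distr (Pi\<^sub>M {..<2::nat} (\<lambda>_. M)) borel (\<lambda>y. \<Sum>i<2. y i)) {s}
      = (\<integral>\<^sup>+u. indicator {s} u \<partial>distr (Pi\<^sub>M {..<2::nat} (\<lambda>_. M)) borel (\<lambda>y. \<Sum>i<2. y i))"
    by simp
  also have "\<dots> = (\<integral>\<^sup>+y. indicator {s} (\<Sum>i<2. y i) \<partial>Pi\<^sub>M {..<2::nat} (\<lambda>_. M))"
    by (subst nn_integral_distr) auto
  also have "\<dots> = (\<integral>\<^sup>+y. indicator {s} (\<Sum>i<2. y i) \<partial>Pi\<^sub>M (insert 1 {0::nat}) (\<lambda>_. M))"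
    by (simp only: I2)
  also have "\<dots> = (\<integral>\<^sup>+y. (\<integral>\<^sup>+v. indicator {s} (\<Sum>i<2. (v(1 := y)) i) \<partial>Pi\<^sub>M {0::nat} (\<lambda>_. M)) \<partial>M)"
    by (subst P.product_nn_integral_insert_rev) (auto simp del: One_nat_def)
  also have "\<dots> = (\<integral>\<^sup>+y. (\<integral>\<^sup>+v. indicator {s - y} (v 0) \<partial>Pi\<^sub>M {0::nat} (\<lambda>_. M)) \<partial>M)"
    by (intro nn_integral_cong) (auto simp: numeral_2_eq_2 split: split_indicator)
  also have "\<dots> = (\<integral>\<^sup>+y. (\<integral>\<^sup>+v. indicator {s - y} v \<partial>M) \<partial>M)"
    by (intro nn_integral_cong P.product_nn_integral_singleton) auto
  also have "\<dots> = (\<integral>\<^sup>+y. emeasure M {s - y} \<partial>M)"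
    by simp
  finally show ?thesis .
qed

text \<open>Stability for two summands gives \<open>Y + Y' = c * Y\<close> in law, with
  \<open>c = 2 powr (1 / \<alpha>)\<close>. If there were atoms, the set \<open>A\<close> of
  heaviest ones would be finite and nonempty, and the convolution identity would make it symmetric
  about \<open>c * z / 2\<close> for every \<open>z\<close> in \<open>A\<close>. Then
  \<open>A\<close> is a single point carrying all the mass, which nondegeneracy excludes.\<close>

lemma strictly_alpha_stable_no_atoms:
  assumes "strictly_alpha_stable \<alpha> \<mu>"
  shows "measure \<mu> {t} = 0"
proof (rule ccontr)
  assume t: "measure \<mu> {t} \<noteq> 0"
  interpret real_distribution \<mu>
    using assms by (simp add: strictly_alpha_stable_def)
  have nondeg: "\<mu> \<noteq> return borel c" for c
    using assms by (simp add: strictly_alpha_stable_def)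
  have [measurable_cong]: "sets \<mu> = sets borel" by simp
  define c :: real where "c = 2 powr (1 / \<alpha>)"
  have c: "c > 0" by (simp add: c_def)
  have "distr (Pi\<^sub>M {..<2::nat} (\<lambda>_. \<mu>)) borel (\<lambda>y. \<Sum>i<2. y i) = distr \<mu> borel (\<lambda>y. c * y)"
    using assms by (auto simp: strictly_alpha_stable_def c_def dest!: spec[of _ "2::nat"])
  then have "(\<integral>\<^sup>+y. emeasure \<mu> {c * z - y} \<partial>\<mu>) = emeasure (distr \<mu> borel (\<lambda>y. c * y)) {c * z}" for z
    by (metis emeasure_sum_two_singleton)
  moreover have "emeasure (distr \<mu> borel (\<lambda>y. c * y)) {c * z} = emeasure \<mu> {z}" for z
  proof -
    have "(*) c -` {c * z} = {z}" using c by auto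
    then show ?thesis by (subst emeasure_distr) auto
  qed
  ultimately have conv: "(\<integral>\<^sup>+y. emeasure \<mu> {c * z - y} \<partial>\<mu>) = emeasure \<mu> {z}" for z
    by simp

  \<comment> \<open>The supremum of the atom masses has to be attained. Points lighter than the
    given atom \<open>t\<close> cannot matter, and only finitely many points are at least as heavy,
    so the maximum over \<open>H\<close> is a maximum over the whole line.\<close>
  define H where "H = {z. measure \<mu> {t} \<le> measure \<mu> {z}}"
  have H: "finite H" "t \<in> H"
    unfolding H_def using t by (auto intro!: finite_heavy_atoms simp: zero_less_measure_iff)
  define a where "a = Max ((\<lambda>z. measure \<mu> {z}) ` H)"
  have a_le: "measure \<mu> {z} \<le> a" for z
  proof (cases "z \<in> H")
    case True then show ?thesis unfolding a_def using H by auto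
  next
    case False
    then have "measure \<mu> {z} \<le> measure \<mu> {t}" by (simp add: H_def)
    also have "\<dots> \<le> a" unfolding a_def using H by auto
    finally show ?thesis .
  qed
  define A where "A = {z. measure \<mu> {z} = a}"
  have a_pos: "a > 0" using a_le[of t] t measure_nonneg[of \<mu> "{t}"] by linarith
  have finA: "finite A"
    by (rule finite_subset[OF _ finite_heavy_atoms[OF a_pos]]) (auto simp: A_def)
  have "a \<in> (\<lambda>z. measure \<mu> {z}) ` H"
    unfolding a_def using H by (intro Max_in) auto
  then obtain t0 where t0: "t0 \<in> A" by (auto simp: A_def)
  \<comment> \<open>The mass of \<open>c z\<close> under \<open>\<mu> * \<mu>\<close> is a \<open>\<mu>\<close>-average of masses \<open>\<le> a\<close>, so it can equal \<open>a\<close> only if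
    almost all of these masses are \<open>a\<close>.\<close>
  have refl: "AE y in \<mu>. c * z - y \<in> A" if z: "z \<in> A" for z
  proof -
    \<comment> \<open>The mass at \<open>c * z - y\<close> is the mass of a section of the line
      \<open>snd x = c * z - fst x\<close>. This line is closed, hence measurable in the product, so
      the mass depends measurably on \<open>y\<close>.\<close>
    have "{x \<in> space (\<mu> \<Otimes>\<^sub>M \<mu>). snd x \<in> {c * z - fst x}}
        = {x :: real \<times> real. snd x = c * z - fst x}"
      by (auto simp: space_pair_measure)
    also have "\<dots> \<in> sets (borel :: (real \<times> real) measure)"
      by (intro borel_closed closed_Collect_eq continuous_intros)
    also have "sets (borel :: (real \<times> real) measure) = sets (\<mu> \<Otimes>\<^sub>M \<mu>)"
      unfolding borel_prod[symmetric]
      by (rule sets_pair_measure_cong[OF events_eq_borel events_eq_borel, symmetric])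
    finally have "(\<lambda>y. emeasure \<mu> {c * z - y}) \<in> borel_measurable \<mu>"
      by (intro measurable_emeasure) auto
    then have meas: "(\<lambda>y. measure \<mu> {c * z - y}) \<in> borel_measurable \<mu>"
      unfolding measure_def by (rule borel_measurable_enn2real)
    have int: "integrable \<mu> (\<lambda>y. measure \<mu> {c * z - y})"
      by (rule integrable_const_bound[where B=1, OF _ meas]) (rule AE_I2, simp)
    have "ennreal (\<integral>y. measure \<mu> {c * z - y} \<partial>\<mu>) = (\<integral>\<^sup>+y. emeasure \<mu> {c * z - y} \<partial>\<mu>)"
      unfolding emeasure_eq_measure
      by (rule nn_integral_eq_integral[OF int, symmetric]) (rule AE_I2, simp)
    also have "\<dots> = ennreal a"
      unfolding conv using z by (simp add: emeasure_eq_measure A_def)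
    finally have "(\<integral>y. measure \<mu> {c * z - y} \<partial>\<mu>) = a"
      using a_pos by (subst (asm) ennreal_inj) (auto intro!: Bochner_Integration.integral_nonneg)
    then have "(\<integral>y. a - measure \<mu> {c * z - y} \<partial>\<mu>) = 0"
      by (subst Bochner_Integration.integral_diff[OF _ int]) (simp_all add: prob_space[simplified])
    moreover have "integrable \<mu> (\<lambda>y. a - measure \<mu> {c * z - y})"
      by (rule Bochner_Integration.integrable_diff[OF _ int]) simp
    moreover have "AE y in \<mu>. 0 \<le> a - measure \<mu> {c * z - y}"
      by (rule AE_I2) (simp add: a_le)
    ultimately have "AE y in \<mu>. a - measure \<mu> {c * z - y} = 0"
      by (simp only: integral_nonneg_eq_0_iff_AE)
    then show ?thesis by eventually_elim (simp add: A_def)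
  qed
  \<comment> \<open>The exceptional null set of \<open>refl\<close> contains no point of
    \<open>A\<close>, because every such point has mass \<open>a > 0\<close>. The almost sure
    statement therefore holds at each point of \<open>A\<close>.\<close>
  have refl': "c * z - y \<in> A" if "z \<in> A" "y \<in> A" for z y
  proof (rule ccontr)
    assume "c * z - y \<notin> A"
    moreover have "AE u in \<mu>. u \<notin> {y}" if "c * z - y \<notin> A"
      using refl[OF \<open>z \<in> A\<close>] by eventually_elim (use that in auto)
    ultimately have "emeasure \<mu> {y} = 0"
      by (subst (asm) AE_iff_measurable[of "{y}"]) auto
    then show False using that a_pos by (simp add: A_def emeasure_eq_measure)
  qed
  \<comment> \<open>So \<open>A\<close> is symmetric about \<open>c z / 2\<close> for each \<open>z \<in> A\<close>; a finite set has only one centre of symmetry.\<close>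
  have sumA: "(\<Sum>y\<in>A. c * z - y) = \<Sum>A" if "z \<in> A" for z
  proof (rule sum.reindex_bij_betw[where g="\<lambda>x. x" and h="\<lambda>y. c * z - y"])
    show "bij_betw (\<lambda>y. c * z - y) A A"
      by (rule bij_betw_byWitness[where f'="\<lambda>y. c * z - y"]) (use refl' that in auto)
  qed
  have "z = t0" if "z \<in> A" for z
  proof -
    have "(\<Sum>y\<in>A. c * z - y) = (\<Sum>y\<in>A. c * t0 - y)"
      using sumA[OF that] sumA[OF t0] by (rule trans[OF _ sym])
    then have "real (card A) * (c * z) = real (card A) * (c * t0)"
      by (simp add: sum_subtractf)
    moreover have "card A > 0" using finA t0 by (auto simp: card_gt_0_iff)
    ultimately show ?thesis using c by simp
  qed
  then have A: "A = {t0}" using t0 by blast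
  \<comment> \<open>Reflection fixes the only point of \<open>A\<close>. Since almost every
    \<open>y\<close> also reflects \<open>t0\<close> into \<open>A\<close>, almost every
    \<open>y\<close> equals \<open>t0\<close>.\<close>
  have ct0: "c * t0 - t0 = t0" using refl'[OF t0 t0] unfolding A by (rule singletonD)
  have "AE y in \<mu>. y = t0"
    using refl[OF t0] unfolding A
  proof eventually_elim
    case (elim y)
    then have "c * t0 - y = t0" by (rule singletonD)
    then show ?case using ct0 by linarith
  qed
  then have "distr \<mu> borel (\<lambda>y. y) = distr \<mu> borel (\<lambda>_. t0)"
    by (intro distr_cong_AE) auto
  moreover have "distr \<mu> borel (\<lambda>y. y) = \<mu>" by (rule distr_id2) simp
  moreover have "distr \<mu> borel (\<lambda>_. t0) = return borel t0" by (rule distr_const) simp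
  ultimately show False using nondeg by simp
qed

section \<open>Tail convergence at a moving threshold\<close>

text \<open>Without atoms the limiting cdf is continuous, so the cdfs converge at every point. The
  moving threshold \<open>t n\<close> is eventually on the correct side of a fixed \<open>u\<close>
  near \<open>t0\<close>, and continuity at \<open>t0\<close> makes the error of replacing
  \<open>t n\<close> by \<open>u\<close> arbitrarily small.\<close>

lemma weak_conv_m_tendsto_upper_tail:
  fixes k :: "nat \<Rightarrow> nat"
  assumes "\<And>k. real_distribution (\<mu> k)" "real_distribution \<nu>"
    and conv: "weak_conv_m \<mu> \<nu>"
    and no_atoms: "\<And>u. measure \<nu> {u} = 0"
    and k: "filterlim k at_top sequentially"
    and t: "t \<longlonglongrightarrow> t0"
  shows "(\<lambda>n. measure (\<mu> (k n)) {t n..}) \<longlonglongrightarrow> measure \<nu> {t0..}"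
proof -
  interpret \<mu>: real_distribution "\<mu> j" for j by fact
  interpret \<nu>: real_distribution \<nu> by fact
  have cont: "isCont (cdf \<nu>) u" for u
    using no_atoms by (simp add: \<nu>.isCont_cdf)
  have cdf: "(\<lambda>n. cdf (\<mu> (k n)) u) \<longlonglongrightarrow> cdf \<nu> u" for u
  proof -
    have "(\<lambda>j. cdf (\<mu> j) u) \<longlonglongrightarrow> cdf \<nu> u"
      using conv cont by (simp add: weak_conv_m_def weak_conv_def)
    from filterlim_compose[OF this k] show ?thesis .
  qed
  have tail: "measure \<nu> {t0..} = 1 - cdf \<nu> t0"
  proof -
    have "measure \<nu> (space \<nu> - {..<t0}) = 1 - measure \<nu> {..<t0}"
      by (rule \<nu>.prob_compl) simp
    moreover have "space \<nu> - {..<t0} = {t0..}" by auto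
    moreover have "measure \<nu> {..t0} = measure \<nu> {..<t0} + measure \<nu> {t0}"
      using \<nu>.finite_measure_Union[of "{..<t0}" "{t0}"] by (simp add: ivl_disj_un_singleton del: Un_insert_right)
    ultimately show ?thesis using no_atoms by (simp add: cdf_def)
  qed
  \<comment> \<open>The comparison with the open tail beyond \<open>u\<close> is strict here and not
    in \<open>ge\<close>: the laws \<open>\<mu> j\<close> may have atoms, and an atom at
    \<open>v\<close> counts in \<open>{v..}\<close>.\<close>
  have le: "measure (\<mu> j) {v..} \<le> 1 - cdf (\<mu> j) u" if "u < v" for j u v
  proof -
    have "measure (\<mu> j) {v..} \<le> measure (\<mu> j) (space (\<mu> j) - {..u})"
      using that by (intro \<mu>.finite_measure_mono) auto
    then show ?thesis by (subst (asm) \<mu>.prob_compl) (auto simp: cdf_def)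
  qed
  have ge: "1 - cdf (\<mu> j) u \<le> measure (\<mu> j) {v..}" if "v \<le> u" for j u v
  proof -
    have "measure (\<mu> j) (space (\<mu> j) - {..u}) \<le> measure (\<mu> j) {v..}"
      using that by (intro \<mu>.finite_measure_mono) auto
    then show ?thesis by (subst (asm) \<mu>.prob_compl) (auto simp: cdf_def)
  qed
  show ?thesis
  proof (rule order_tendstoI)
    fix l assume "l < measure \<nu> {t0..}"
    then have "\<forall>\<^sub>F u in at t0. l < 1 - cdf \<nu> u"
      unfolding tail by (rule order_tendstoD(1)[OF tendsto_diff[OF tendsto_const cont[of t0, unfolded isCont_def]]])
    then have "\<forall>\<^sub>F u in at_right t0. l < 1 - cdf \<nu> u" by (simp add: eventually_at_split)
    moreover have "\<forall>\<^sub>F u in at_right t0. u > t0" by (rule eventually_at_right_less)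
    ultimately have "\<forall>\<^sub>F u in at_right t0. l < 1 - cdf \<nu> u \<and> u > t0" by (rule eventually_conj)
    then obtain u where u: "l < 1 - cdf \<nu> u" "u > t0"
      using eventually_happens'[OF trivial_limit_at_right_real] by fastforce
    have "(\<lambda>n. 1 - cdf (\<mu> (k n)) u) \<longlonglongrightarrow> 1 - cdf \<nu> u" by (intro tendsto_intros cdf)
    from order_tendstoD(1)[OF this u(1)] order_tendstoD(2)[OF t u(2)]
    show "\<forall>\<^sub>F n in sequentially. l < measure (\<mu> (k n)) {t n..}"
    proof eventually_elim
      case (elim n)
      then show ?case using ge[of "t n" u "k n"] by linarith
    qed
  next
    fix l assume "measure \<nu> {t0..} < l"
    then have "\<forall>\<^sub>F u in at t0. 1 - cdf \<nu> u < l"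
      unfolding tail by (rule order_tendstoD(2)[OF tendsto_diff[OF tendsto_const cont[of t0, unfolded isCont_def]]])
    then have "\<forall>\<^sub>F u in at_left t0. 1 - cdf \<nu> u < l" by (simp add: eventually_at_split)
    moreover have "\<forall>\<^sub>F u in at_left t0. u < t0" by (simp add: eventually_at_filter)
    ultimately have "\<forall>\<^sub>F u in at_left t0. 1 - cdf \<nu> u < l \<and> u < t0" by (rule eventually_conj)
    then obtain u where u: "1 - cdf \<nu> u < l" "u < t0"
      using eventually_happens'[OF trivial_limit_at_left_real] by fastforce
    have "(\<lambda>n. 1 - cdf (\<mu> (k n)) u) \<longlonglongrightarrow> 1 - cdf \<nu> u" by (intro tendsto_intros cdf)
    from order_tendstoD(2)[OF this u(1)] order_tendstoD(1)[OF t u(2)]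
    show "\<forall>\<^sub>F n in sequentially. measure (\<mu> (k n)) {t n..} < l"
    proof eventually_elim
      case (elim n)
      then show ?case using le[of u "t n" "k n"] by linarith
    qed
  qed
qed

section \<open>Conditioning on a random index\<close>

text \<open>The event is split by the value of \<open>T\<close>, each piece factorises, and the
  resulting series is the expectation of a function of \<open>T\<close>. Independence is needed only
  between \<open>A k\<close> and \<open>T = k\<close> for the same \<open>k\<close>.\<close>

lemma (in prob_space) prob_random_index:
  fixes T :: "'a \<Rightarrow> nat"
  assumes [measurable]: "T \<in> M \<rightarrow>\<^sub>M count_space UNIV" "\<And>k. A k \<in> events"
    and indep: "\<And>k. prob (A k \<inter> {w \<in> space M. T w = k}) = prob (A k) * prob {w \<in> space M. T w = k}"
  shows "prob {w \<in> space M. w \<in> A (T w)} = expectation (\<lambda>w. prob (A (T w)))"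
proof -
  let ?E = "\<lambda>k. {w \<in> space M. T w = k}"
  have int: "integrable M (\<lambda>w. prob (A (T w)))"
    by (rule integrable_const_bound[where B=1]) auto
  have un: "{w \<in> space M. w \<in> A (T w)} = (\<Union>k. A k \<inter> ?E k)" by auto
  have "emeasure M {w \<in> space M. w \<in> A (T w)} = (\<Sum>k. emeasure M (A k \<inter> ?E k))"
    unfolding un by (rule suminf_emeasure[symmetric]) (auto simp: disjoint_family_on_def)
  also have "\<dots> = (\<Sum>k. \<integral>\<^sup>+w. ennreal (prob (A k)) * indicator (?E k) w \<partial>M)"
    by (subst nn_integral_cmult_indicator) (auto simp: emeasure_eq_measure indep ennreal_mult)
  also have "\<dots> = (\<integral>\<^sup>+w. (\<Sum>k. ennreal (prob (A k)) * indicator (?E k) w) \<partial>M)"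
    by (rule nn_integral_suminf[symmetric]) auto
  also have "\<dots> = (\<integral>\<^sup>+w. ennreal (prob (A (T w))) \<partial>M)"
  proof (rule nn_integral_cong)
    fix w assume "w \<in> space M"
    then have "(\<Sum>k. ennreal (prob (A k)) * indicator (?E k) w)
        = (\<Sum>k\<in>{T w}. ennreal (prob (A k)) * indicator (?E k) w)"
      by (intro suminf_finite) (auto split: split_indicator)
    then show "(\<Sum>k. ennreal (prob (A k)) * indicator (?E k) w) = ennreal (prob (A (T w)))"
      using \<open>w \<in> space M\<close> by simp
  qed
  also have "\<dots> = ennreal (expectation (\<lambda>w. prob (A (T w))))"
    using int by (intro nn_integral_eq_integral) auto
  finally show ?thesis
    by (simp add: emeasure_eq_measure integral_nonneg_AE)
qed

theorem theorem1p16: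
  fixes M :: "'a measure" and N :: "'b measure"
    and p :: "nat pmf" and m :: real
    and Z :: "nat \<Rightarrow> 'a \<Rightarrow> nat" and W :: "'a \<Rightarrow> real" and \<omega> :: "real \<Rightarrow> real"
    and X S :: "nat \<Rightarrow> 'a \<Rightarrow> real" and F :: "real \<Rightarrow> real" and U :: "'b \<Rightarrow> real"
    and L b s :: "real \<Rightarrow> real" and \<epsilon> :: "nat \<Rightarrow> real" and \<alpha> \<beta> x :: real
  assumes M: "prob_space M"
    \<comment> \<open>the Galton-Watson process\<close>
    and Z: "galton_watson M p Z"
    and p0: "pmf p 0 = 0" and p1: "0 < pmf p 1" "pmf p 1 < 1"
    and m: "integrable (measure_pmf p) real" "m = measure_pmf.expectation p real" "m > 1"
    and ZlogZ: "integrable M (\<lambda>w. real (Z 1 w) * ln (real (Z 1 w)))"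
    and W_lim: "AE w in M. (\<lambda>n. real (Z n w) / m ^ n) \<longlonglongrightarrow> W w"
    and W_density: "distributed M lborel W (\<lambda>u. ennreal (indicator {0<..} u * \<omega> u))"
    and \<omega>: "continuous_on {0<..} \<omega>" "\<forall>u>0. 0 \<le> \<omega> u"
    \<comment> \<open>the summands\<close>
    and X_indep: "prob_space.indep_vars M (\<lambda>_. borel) X {1..}"
    and X_ident: "\<forall>i\<ge>1. distr M borel (X i) = distr M borel (X 1)"
    and X_Z_indep: "prob_space.indep_var M
          (Pi\<^sub>M {1..} (\<lambda>_. borel)) (\<lambda>w. \<lambda>i\<in>{1..}. X i w)
          (Pi\<^sub>M UNIV (\<lambda>_. borel)) (\<lambda>w n. real (Z n w))"
    and F: "\<forall>y. F y = measure M {w \<in> space M. X 1 w \<le> y}"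
    and S: "\<forall>n. \<forall>w. S n w = (\<Sum>i=1..n. X i w)"
    and \<alpha>: "0 < \<alpha>" "\<alpha> < 2"
    \<comment> \<open>Standing Assumption A\<close>
    and A1: "\<beta> > 0" "slowly_varying L"
          "asymp_equiv (\<lambda>y. measure M {w \<in> space M. X 1 w \<ge> y}) at_top (\<lambda>y. y powr (- \<beta>) * L y)"
    and A2: "\<epsilon> \<longlonglongrightarrow> 0 \<Longrightarrow> \<forall>K. compact K \<and> K \<subseteq> {0..} \<longrightarrow> (\<exists>c>0. \<exists>C. \<forall>y\<in>K. c \<le> L y \<and> L y \<le> C)"
    and A3_U: "prob_space N" "U \<in> borel_measurable N" "alpha_stable \<alpha> (distr N borel U)"
    and A3_b: "continuous_on {0..} b" "mono_on {0..} b" "b ` {0..} = {0..}" "b 0 = 0"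
    and A3_s: "slowly_varying s" "\<forall>y>0. b y = y powr (1 / \<alpha>) * s y"
    and A3_lim: "weak_conv_m (\<lambda>k. distr M borel (\<lambda>w. S k w / b (real k))) (distr N borel U)"
    and A4: "1 < \<alpha> \<Longrightarrow> integrable M (X 1) \<and> prob_space.expectation M (X 1) = 0"
    \<comment> \<open>Standing Assumption B\<close>
    and B1: "strictly_alpha_stable \<alpha> (distr N borel U)"
    and B2: "1 < \<alpha> \<Longrightarrow> 0 < Liminf at_top (\<lambda>y. ereal (s y))"
    and B3: "0 < p_plus F \<Longrightarrow> p_plus F < 1 \<Longrightarrow> \<alpha> = 1 \<Longrightarrow>
          \<forall>y>0. (LINT t:{- y..y}|distr M borel (X 1). t) = 0"
    and B4: "p_plus F = 0 \<Longrightarrow> \<alpha> < \<beta>"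
    and B5: "1 < \<alpha> \<Longrightarrow> p_plus F > 0 \<Longrightarrow>
          limsup (\<lambda>n. ereal (F (- b (real n) / ln (real n) powr (1 / \<alpha>)) /
            (ln (real n) * F (- b (real n))))) \<le> 1"
    and \<epsilon>: "(\<lambda>n. \<epsilon> n * m ^ n * inverse (b (m ^ n))) \<longlonglongrightarrow> x"
  shows "(\<lambda>n. measure M {w \<in> space M. S (Z n w) w / real (Z n w) \<ge> \<epsilon> n})
           \<longlonglongrightarrow> (LINT u:{0<..}|lborel.
                  measure N {v \<in> space N. U v \<ge> u powr ((\<alpha> - 1) / \<alpha>) * x} * \<omega> u)"
  proof -
  interpret M: prob_space M by (rule M)
  interpret N: prob_space N by (rule A3_U(1))
  define \<nu> where "\<nu> = distr N borel U"
  interpret \<nu>: real_distribution \<nu>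
    using B1 by (simp add: strictly_alpha_stable_def \<nu>_def)
  have [measurable]: "U \<in> borel_measurable N" by (rule A3_U(2))
  have no_atoms: "measure \<nu> {u} = 0" for u
    using strictly_alpha_stable_no_atoms[OF B1] by (simp add: \<nu>_def)

  \<comment> \<open>Measurability and conditioning on the generation size\<close>
  have rvZ: "(\<lambda>w n. real (Z n w)) \<in> M \<rightarrow>\<^sub>M Pi\<^sub>M UNIV (\<lambda>_. borel)"
    using X_Z_indep by (rule M.indep_var_rv2)
  have X_meas[measurable]: "X i \<in> borel_measurable M" if "i \<ge> 1" for i
    using X_indep that by (auto simp: M.indep_vars_def)
  have S_meas[measurable]: "S k \<in> borel_measurable M" for k
  proof -
    have "(\<lambda>w. \<Sum>i=1..k. X i w) \<in> borel_measurable M" by (intro borel_measurable_sum) auto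
    moreover have "S k = (\<lambda>w. \<Sum>i=1..k. X i w)" using S by auto
    ultimately show ?thesis by simp
  qed
  have Zr_meas: "(\<lambda>w. real (Z n w)) \<in> borel_measurable M" for n
    using measurable_compose[OF rvZ measurable_component_singleton[of n]] by simp
  have Z_meas[measurable]: "Z n \<in> M \<rightarrow>\<^sub>M count_space UNIV" for n
  proof -
    \<comment> \<open>The independence assumption provides \<open>Z n\<close> as a real random
      variable. Taking the floor recovers the discrete one.\<close>
    have "(\<lambda>w. nat \<lfloor>real (Z n w)\<rfloor>) \<in> M \<rightarrow>\<^sub>M count_space UNIV"
      using Zr_meas[of n] by measurable
    then show ?thesis by simp
  qed

  define A where "A n k = {w \<in> space M. S k w / real k \<ge> \<epsilon> n}" for n k
  have A_meas[measurable]: "A n k \<in> M.events" for n k unfolding A_def by measurable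
  have indep: "M.prob (A n k \<inter> {w \<in> space M. Z n w = k})
      = M.prob (A n k) * M.prob {w \<in> space M. Z n w = k}" for n k
  proof -
    have 1: "(\<lambda>x. \<Sum>i=1..k. x i) \<in> Pi\<^sub>M {1..} (\<lambda>_. borel) \<rightarrow>\<^sub>M (borel :: real measure)"
      by (intro borel_measurable_sum measurable_component_singleton) auto
    have 2: "(\<lambda>z. z n) \<in> Pi\<^sub>M UNIV (\<lambda>_. borel) \<rightarrow>\<^sub>M (borel :: real measure)"
      by (intro measurable_component_singleton) auto
    \<comment> \<open>The events depend on the two independent sequences through the measurable maps
      "sum of the first \<open>k\<close> terms" and "coordinate \<open>n\<close>".\<close>
    have "M.prob ((\<lambda>w. (((\<lambda>x. \<Sum>i=1..k. x i) \<circ> (\<lambda>w. \<lambda>i\<in>{1..}. X i w)) w,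
          ((\<lambda>z. z n) \<circ> (\<lambda>w n. real (Z n w))) w)) -` ({y. y / real k \<ge> \<epsilon> n} \<times> {real k}) \<inter> space M)
        = M.prob (((\<lambda>x. \<Sum>i=1..k. x i) \<circ> (\<lambda>w. \<lambda>i\<in>{1..}. X i w)) -` {y. y / real k \<ge> \<epsilon> n} \<inter> space M)
          * M.prob (((\<lambda>z. z n) \<circ> (\<lambda>w n. real (Z n w))) -` {real k} \<inter> space M)"
      by (rule M.indep_varD[OF M.indep_var_compose[OF X_Z_indep 1 2]]) measurable
    then show ?thesis
      by (simp add: A_def S vimage_def Int_def conj_ac o_def cong: conj_cong)
  qed
  have prob_eq: "measure M {w \<in> space M. S (Z n w) w / real (Z n w) \<ge> \<epsilon> n}
      = M.expectation (\<lambda>w. M.prob (A n (Z n w)))" for n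
    using M.prob_random_index[of "Z n" "A n", OF Z_meas A_meas indep]
    by (simp add: A_def cong: conj_cong)

  \<comment> \<open>Normalised sums and the limiting tail function\<close>
  have b_pos: "b v > 0" if "v > 0" for v
    using that A3_s by (simp add: slowly_varying_def)
  have b_rv: "((\<lambda>v. b (c * v) / b v) \<longlongrightarrow> c powr (1 / \<alpha>)) at_top" if c: "c > 0" for c
  proof -
    have "((\<lambda>v. c powr (1 / \<alpha>) * (s (c * v) / s v)) \<longlongrightarrow> c powr (1 / \<alpha>) * 1) at_top"
      using A3_s(1) c by (intro tendsto_intros) (auto simp: slowly_varying_def)
    moreover have "\<forall>\<^sub>F v in at_top. c powr (1 / \<alpha>) * (s (c * v) / s v) = b (c * v) / b v"
      using eventually_gt_at_top[of 0]
      by eventually_elim (use c A3_s(2) in \<open>auto simp: powr_mult\<close>)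
    ultimately show ?thesis by (auto intro: Lim_transform_eventually)
  qed

  define \<mu> where "\<mu> k = distr M borel (\<lambda>w. S k w / b (real k))" for k
  have \<mu>: "real_distribution (\<mu> k)" for k
    unfolding \<mu>_def by (rule M.real_distribution_distr) measurable
  \<comment> \<open>The case \<open>k = 0\<close> must be excluded: division by zero yields 0, so
    the right side would be 1, while \<open>A n 0\<close> is empty when
    \<open>\<epsilon> n > 0\<close>.\<close>
  have A_\<mu>: "M.prob (A n k) = measure (\<mu> k) {real k * \<epsilon> n / b (real k)..}" if "k > 0" for n k
  proof -
    have "A n k = (\<lambda>w. S k w / b (real k)) -` {real k * \<epsilon> n / b (real k)..} \<inter> space M"
      using b_pos[of "real k"] that by (auto simp: A_def field_simps)
    then show ?thesis unfolding \<mu>_def by (subst measure_distr) auto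
  qed

  define g where "g u = measure \<nu> {u powr ((\<alpha> - 1) / \<alpha>) * x..}" for u
  have g_eq: "g u = measure N {v \<in> space N. U v \<ge> u powr ((\<alpha> - 1) / \<alpha>) * x}" for u
    unfolding g_def \<nu>_def by (subst measure_distr) (auto intro!: arg_cong[where f="measure N"])
  have g_meas[measurable]: "g \<in> borel_measurable borel"
  proof -
    \<comment> \<open>The upper tail is decreasing, so its negative is monotone and hence
      Borel.\<close>
    have "mono (\<lambda>v. - measure \<nu> {v..})"
      by (auto intro!: monoI \<nu>.finite_measure_mono)
    then have "(\<lambda>v. - measure \<nu> {v..}) \<in> borel_measurable borel" by (rule borel_measurable_mono)
    then have [measurable]: "(\<lambda>v. measure \<nu> {v..}) \<in> borel_measurable borel"
      by (simp only: borel_measurable_uminus_eq)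
    show ?thesis unfolding g_def by measurable
  qed
  have W_meas[measurable]: "W \<in> borel_measurable M"
    using W_density by (auto simp: distributed_def)
  \<comment> \<open>The density of \<open>W\<close> carries the indicator of \<open>{0<..}\<close>.
    Positivity of the limit is what forces \<open>Z n w\<close> to infinity and allows regular
    variation to be applied at \<open>W w\<close>.\<close>
  have W_pos: "AE w in M. W w > 0"
  proof -
    have "AE u in distr M lborel W. u > 0"
      unfolding distributed_distr_eq_density[OF W_density]
      using W_density by (subst AE_density) (auto simp: distributed_def indicator_def)
    then show ?thesis by (subst (asm) AE_distr_iff) auto
  qed

  \<comment> \<open>Almost sure limit of the conditional probabilities\<close>
  have lim: "AE w in M. (\<lambda>n. M.prob (A n (Z n w))) \<longlonglongrightarrow> g (W w)"
    using W_lim W_pos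
  proof eventually_elim
    case (elim w)
    have mn: "filterlim (\<lambda>n. m ^ n) at_top sequentially"
      using m(3) filterlim_realpow_sequentially_gt1[of m]
      by (intro filterlim_at_infinity_imp_filterlim_at_top) auto
    have "filterlim (\<lambda>n. real (Z n w) / m ^ n * m ^ n) at_top sequentially"
      by (rule filterlim_tendsto_pos_mult_at_top[OF elim mn])
    then have Zr: "filterlim (\<lambda>n. real (Z n w)) at_top sequentially"
      using m(3) by simp
    then have Zlim: "filterlim (\<lambda>n. Z n w) at_top sequentially"
      by (simp add: filterlim_sequentially_iff_filterlim_real)
    have Zpos: "\<forall>\<^sub>F n in sequentially. Z n w > 0"
      using Zlim eventually_gt_at_top[of 0] by (rule eventually_compose_filterlim[rotated])
    have "(\<lambda>n. b (real (Z n w)) / b (m ^ n)) \<longlonglongrightarrow> W w powr (1 / \<alpha>)"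
      by (rule mono_regularly_varying_tendsto[OF A3_b(2) b_pos b_rv mn elim])
    \<comment> \<open>The threshold \<open>k * \<epsilon> n / b k\<close> with
      \<open>k = Z n w\<close> is factored through \<open>m ^ n\<close> so that each factor has a
      known limit: the martingale ratio, the hypothesis on \<open>\<epsilon>\<close>, and the ratio
      of the two values of \<open>b\<close>.\<close>
    then have "(\<lambda>n. real (Z n w) / m ^ n * (\<epsilon> n * m ^ n * inverse (b (m ^ n)))
        / (b (real (Z n w)) / b (m ^ n))) \<longlonglongrightarrow> W w * x / W w powr (1 / \<alpha>)"
      using elim by (intro tendsto_intros \<epsilon>) auto
    moreover have "real (Z n w) / m ^ n * (\<epsilon> n * m ^ n * inverse (b (m ^ n)))
        / (b (real (Z n w)) / b (m ^ n)) = real (Z n w) * \<epsilon> n / b (real (Z n w))" for n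
      using m(3) b_pos[of "m ^ n"] by (simp add: field_simps)
    moreover have "W w * x / W w powr (1 / \<alpha>) = W w powr ((\<alpha> - 1) / \<alpha>) * x"
    proof -
      have "(\<alpha> - 1) / \<alpha> = 1 - 1 / \<alpha>" using \<alpha> by (simp add: field_simps)
      then show ?thesis using elim by (simp add: powr_diff)
    qed
    ultimately have t: "(\<lambda>n. real (Z n w) * \<epsilon> n / b (real (Z n w)))
        \<longlonglongrightarrow> W w powr ((\<alpha> - 1) / \<alpha>) * x" by (simp only:)
    have "weak_conv_m \<mu> \<nu>" using A3_lim by (simp add: \<mu>_def[abs_def] \<nu>_def)
    from weak_conv_m_tendsto_upper_tail[OF \<mu> \<nu>.real_distribution_axioms this no_atoms Zlim t]
    have "(\<lambda>n. measure (\<mu> (Z n w)) {real (Z n w) * \<epsilon> n / b (real (Z n w))..}) \<longlonglongrightarrow> g (W w)"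
      by (simp add: g_def)
    then show ?case
      by (rule Lim_transform_eventually) (use Zpos in eventually_elim, simp add: A_\<mu>)
  qed

  \<comment> \<open>Dominated convergence and integration against the density of
    \<open>W\<close>\<close>
  have "(\<lambda>n. M.expectation (\<lambda>w. M.prob (A n (Z n w)))) \<longlonglongrightarrow> M.expectation (\<lambda>w. g (W w))"
  proof (rule integral_dominated_convergence[where w="\<lambda>_. 1", OF _ _ _ lim])
    show "(\<lambda>w. g (W w)) \<in> borel_measurable M"
      using W_meas g_meas by (rule measurable_compose)
    show "(\<lambda>w. M.prob (A n (Z n w))) \<in> borel_measurable M" for n
      by (rule measurable_compose[OF Z_meas]) simp
    show "AE w in M. norm (M.prob (A n (Z n w))) \<le> 1" for n
      by (rule AE_I2) simp
  qed simp
  moreover have "M.expectation (\<lambda>w. g (W w))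
      = (\<integral>u. (indicator {0<..} u * \<omega> u) * g u \<partial>lborel)"
    using \<omega>(2)
    by (intro distributed_integral[OF W_density, symmetric]) (auto simp: indicator_def)
  moreover have "(\<integral>u. (indicator {0<..} u * \<omega> u) * g u \<partial>lborel)
      = (LINT u:{0<..}|lborel. measure N {v \<in> space N. U v \<ge> u powr ((\<alpha> - 1) / \<alpha>) * x} * \<omega> u)"
    unfolding set_lebesgue_integral_def g_eq by (simp add: ac_simps)
  ultimately show ?thesis by (simp add: prob_eq)
qed

end
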